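(* Fix the word $w$ and consider the rank function $\mathbb L_w(q)$ of lattice paths on the snake graph $G_w$, where $G_w$ starts by going right and is built from $d$ maximal straight segments. Let $u=\lfloor\frac{d-1}{2}\rfloor$ and let $B_u=\{0,1\}^u$ be the Boolean lattice of rank $u$. Then $$\mathbb L_w(q)=\sum_{\sigma\in B_u}H_\sigma ,$$ where $H_\sigma$ are the polynomials in $q$ defined in the context.
   Context: A snake graph with $n$ tiles is a planar graph in $\mathbb Z^2$ formed by unit squares $T_1,\dots,T_n$, $T_1$ having SW corner $(0,0)$, where each $T_{i+1}$ is glued directly to the right of or directly above $T_i$. Its shape is the word of length $n-1$ in $\{a,b\}$ whose $i$-th letter is $a$ (resp. $b$) if $T_{i+1}$ is right of (resp. above) $T_i$. For a word $w=w_1w_2\cdots w_{n-1}$ over $\{a,b\}$, $G_w$ is the snake graph of shape $w^*=w_1^*w_2w_3^*w_4\cdots$, where $a^*=b$, $b^*=a$. $G_w$ starts by going right if $T_2$ is to the right of $T_1$. $\mathbb L_w$ is the poset of lattice paths (unit steps right or up along edges of $G_w$, from the SW vertex of $T_1$ to the NE vertex of $T_n$), where $L_2$ covers $L_1$ iff $L_2$ arises from $L_1$ by replacing the S and E edges of a tile by its W and N edges. It is a graded (distributive) lattice; $\mathbb L_w(q)=\sum_i r_iq^i$, with $r_i$ the number of lattice paths of rank $i$. Decompose $G_w$ into its $d\ge2$ maximal overlapping straight segments: $k_1$ is the number of tiles in the first row or column, $k_d$ the number in the last row or column, and $k_i+1$ the number of tiles in the $i$-th row or column for $1<i<d$. (E.g.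 for $d=4$ the shape is $a^{k_1-1}b^{k_2}a^{k_3}b^{k_4-1}$.) Write $[k]_q=1+q+\dots+q^{k-1}$. Put - $H_{i,i+1}=1+q[k_i]_q[k_{i+1}]_q$; - $H_i=[k_i]_q$; - $H^{i,i+1}=q^{k_i+k_{i+1}+1}$ if $i\ne1$ and $i+1\neq d$, and $H^{i,i+1}=q^{k_i+k_{i+1}}$ if $i=1$ or $i+1=d$. Products of symbols with upper indices are taken with the multiplication $\circ$: for $i<j$, $H^{i,i+1}\circ H^{j,j+1}=H^{i,i+1}H^{j,j+1}$ if $j\ne i+2$ and $q^{-1}H^{i,i+1}H^{j,j+1}$ if $j=i+2$, extended to several factors (one factor $q^{-1}$ for each pair of indices $i,\,i+2$ both occurring). The $H_\sigma$ are obtained by starting with $H_{(0,\dots,0)}=H_{1,2}H_{3,4}\cdots H_{d-2,d-1}H_d$ ($d$ odd) or $H_{1,2}H_{3,4}\cdots H_{d-1,d}$ ($d$ even) and applying the local replacements $H_iH_{i+1}\mapsto H^{i,i+1}$, $H_{i,i+1}H_{i+2}\mapsto H_iH^{i+1,i+2}$, $H_iH_{i+1,i+2}\mapsto H^{i,i+1}H_{i+2}$, $H_{i,i+1}H_{i+2,i+3}\mapsto H_iH^{i+1,i+2}H_{i+3}$; the element $H_\sigma$, $\sigma=(\sigma_1,\dots,\sigma_u)$, is the one in which $H^{2j,2j+1}$ occurs exactly when $\sigma_j=1$. Explicitly, call an index in $\{1,\dots,d\}$ used if it belongs to $\{2j,2j+1\}$ for some $j$ with $\sigma_j=1$. Then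 $H_\sigma$ is the $\circ$-product of the $H^{2j,2j+1}$ with $\sigma_j=1$, times, for each pair $(2j-1,2j)$ with $2j\le d$: $H_{2j-1,2j}$ if neither index is used, $H_i$ if exactly one index $i$ of the pair is unused, $1$ if both are used; times $H_d$ if $d$ is odd and $d$ is unused. *)

theory Defs
  imports
    "HOL-Computational_Algebra.Polynomial"
    "HOL-Library.FuncSet"
begin

section \<open>Snake graphs\<close>

datatype letter = La | Lb

type_synonym vertex = "int \<times> int"

text \<open>An edge is the pair of its endpoints, oriented right or up (SW endpoint first), so that an
  edge is at the same time a unit step of a lattice path.\<close>

type_synonym edge = "vertex \<times> vertex"

fun star :: "letter \<Rightarrow> letter" where
  "star La = Lb"
| "star Lb = La"

text \<open>Letters are counted from \<open>1\<close> in the mathematical notation and from \<open>0\<close> by \<open>nth\<close>: the letters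
  \<open>w\<^sub>1, w\<^sub>3, \<dots>\<close> that are exchanged are those at even list positions.\<close>

definition snake_shape :: "letter list \<Rightarrow> letter list" where
  "snake_shape w = map (\<lambda>i. if even i then star (w ! i) else w ! i) [0..<length w]"

text \<open>A tile is represented by its SW corner.\<close>

fun tiles_from :: "vertex \<Rightarrow> letter list \<Rightarrow> vertex list" where
  "tiles_from t [] = [t]"
| "tiles_from (x, y) (La # s) = (x, y) # tiles_from (x + 1, y) s"
| "tiles_from (x, y) (Lb # s) = (x, y) # tiles_from (x, y + 1) s"

definition snake_tiles :: "letter list \<Rightarrow> vertex list" where
  "snake_tiles w = tiles_from (0, 0) (snake_shape w)"

fun south_edge :: "vertex \<Rightarrow> edge" where
  "south_edge (x, y) = ((x, y), (x + 1, y))"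

fun east_edge :: "vertex \<Rightarrow> edge" where
  "east_edge (x, y) = ((x + 1, y), (x + 1, y + 1))"

fun west_edge :: "vertex \<Rightarrow> edge" where
  "west_edge (x, y) = ((x, y), (x, y + 1))"

fun north_edge :: "vertex \<Rightarrow> edge" where
  "north_edge (x, y) = ((x, y + 1), (x + 1, y + 1))"

fun ne_vertex :: "vertex \<Rightarrow> vertex" where
  "ne_vertex (x, y) = (x + 1, y + 1)"

definition snake_edges :: "letter list \<Rightarrow> edge set" where
  "snake_edges w =
    (\<Union>t\<in>set (snake_tiles w). {south_edge t, east_edge t, west_edge t, north_edge t})"

definition starts_right :: "letter list \<Rightarrow> bool" where
  "starts_right w \<longleftrightarrow> snake_shape w \<noteq> [] \<and> hd (snake_shape w) = La"

section \<open>The poset of lattice paths and its rank generating polynomial\<close>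

definition lattice_paths :: "letter list \<Rightarrow> edge list set" where
  "lattice_paths w = {L. L \<noteq> [] \<and> set L \<subseteq> snake_edges w
     \<and> fst (hd L) = hd (snake_tiles w)
     \<and> snd (last L) = ne_vertex (last (snake_tiles w))
     \<and> successively (\<lambda>e f. snd e = fst f) L}"

text \<open>\<open>covered_by w L\<^sub>1 L\<^sub>2\<close> means that \<open>L\<^sub>2\<close> covers \<open>L\<^sub>1\<close>. On a path that contains the S and E edges
  of a tile these two steps are consecutive.\<close>

definition covered_by :: "letter list \<Rightarrow> edge list \<Rightarrow> edge list \<Rightarrow> bool" where
  "covered_by w L\<^sub>1 L\<^sub>2 \<longleftrightarrow> L\<^sub>1 \<in> lattice_paths w \<and> L\<^sub>2 \<in> lattice_paths w \<and>
     (\<exists>t\<in>set (snake_tiles w). \<exists>xs ys.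
        L\<^sub>1 = xs @ [south_edge t, east_edge t] @ ys \<and>
        L\<^sub>2 = xs @ [west_edge t, north_edge t] @ ys)"

text \<open>In a finite graded poset the rank of an element is the common length of all saturated chains
  that lead to it from a minimal element.\<close>

definition path_rank :: "letter list \<Rightarrow> edge list \<Rightarrow> nat" where
  "path_rank w L = (THE i. \<exists>M\<in>lattice_paths w.
     (\<nexists>L'. covered_by w L' M) \<and> (covered_by w ^^ i) M L)"

definition rank_number :: "letter list \<Rightarrow> nat \<Rightarrow> nat" where
  "rank_number w i = card {L \<in> lattice_paths w. path_rank w L = i}"

abbreviation q :: "int poly" where
  "q \<equiv> [:0, 1:]"

definition rank_poly :: "letter list \<Rightarrow> int poly" where
  "rank_poly w = (\<Sum>i\<in>path_rank w ` lattice_paths w. of_nat (rank_number w i) * q ^ i)"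

section \<open>Straight segments\<close>

function runs :: "'a list \<Rightarrow> 'a list list" where
  "runs [] = []"
| "runs (x # xs) = (x # takeWhile ((=) x) xs) # runs (dropWhile ((=) x) xs)"
  by pat_completeness auto
termination
  by (relation "measure length") (auto simp: length_dropWhile_le less_Suc_eq_le)

text \<open>A maximal run of \<open>l\<close> equal letters in the shape glues \<open>l + 1\<close> tiles into a maximal row or
  column; consecutive segments share their corner tile.\<close>

definition segment_tiles :: "letter list \<Rightarrow> nat list" where
  "segment_tiles w = map (\<lambda>r. length r + 1) (runs (snake_shape w))"

definition num_segments :: "letter list \<Rightarrow> nat" where
  "num_segments w = length (segment_tiles w)"

definition seg_len :: "letter list \<Rightarrow> nat \<Rightarrow> nat" where
  "seg_len w i =
    (if i = 1 \<or> i = num_segments w then segment_tiles w ! (i - 1) else segment_tiles w ! (i - 1) - 1)"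

section \<open>The polynomials \<open>H\<^sub>\<sigma>\<close>\<close>

text \<open>Here \<open>d\<close> is the number of segments and \<open>k i\<close>, for \<open>1 \<le> i \<le> d\<close>, their length parameters.\<close>

definition qint :: "nat \<Rightarrow> int poly" where
  "qint n = (\<Sum>j<n. q ^ j)"

definition H_low :: "(nat \<Rightarrow> nat) \<Rightarrow> nat \<Rightarrow> int poly" where
  "H_low k i = qint (k i)"

definition H_low2 :: "(nat \<Rightarrow> nat) \<Rightarrow> nat \<Rightarrow> int poly" where
  "H_low2 k i = 1 + q * qint (k i) * qint (k (i + 1))"

definition H_up :: "nat \<Rightarrow> (nat \<Rightarrow> nat) \<Rightarrow> nat \<Rightarrow> int poly" where
  "H_up d k i =
    (if i \<noteq> 1 \<and> i + 1 \<noteq> d then q ^ (k i + k (i + 1) + 1) else q ^ (k i + k (i + 1)))"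

text \<open>The product of the \<open>H_up d k i\<close>, \<open>i \<in> I\<close>, under \<open>\<circ>\<close>. The division by the power of \<open>q\<close> is exact
  (\<open>H_circ_exact\<close> below).\<close>

definition H_circ :: "nat \<Rightarrow> (nat \<Rightarrow> nat) \<Rightarrow> nat set \<Rightarrow> int poly" where
  "H_circ d k I = (\<Prod>i\<in>I. H_up d k i) div q ^ card {i \<in> I. i + 2 \<in> I}"

lemma H_circ_exact:
  assumes "finite I" and "\<And>i. i \<in> I \<Longrightarrow> k i \<ge> 1"
  shows "H_circ d k I * q ^ card {i \<in> I. i + 2 \<in> I} = (\<Prod>i\<in>I. H_up d k i)"
proof -
  have "q dvd H_up d k i" if "i \<in> I" for i
    using assms(2)[OF that] unfolding H_up_def
    by (auto intro!: dvd_power simp del: mult_pCons_left)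
  then have "(\<Prod>i\<in>I. q) dvd (\<Prod>i\<in>I. H_up d k i)"
    by (rule prod_dvd_prod)
  then have "q ^ card I dvd (\<Prod>i\<in>I. H_up d k i)"
    by simp
  moreover have "q ^ card {i \<in> I. i + 2 \<in> I} dvd q ^ card I"
    using assms(1) by (intro le_imp_power_dvd card_mono) auto
  ultimately have "q ^ card {i \<in> I. i + 2 \<in> I} dvd (\<Prod>i\<in>I. H_up d k i)"
    by (rule dvd_trans[rotated])
  then show ?thesis
    unfolding H_circ_def by (rule dvd_div_mult_self)
qed

definition up_indices :: "nat \<Rightarrow> (nat \<Rightarrow> nat) \<Rightarrow> nat set" where
  "up_indices u \<sigma> = {2 * j | j. j \<in> {1..u} \<and> \<sigma> j = 1}"

definition used :: "nat \<Rightarrow> (nat \<Rightarrow> nat) \<Rightarrow> nat \<Rightarrow> bool" where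
  "used u \<sigma> i \<longleftrightarrow> (\<exists>j\<in>{1..u}. \<sigma> j = 1 \<and> i \<in> {2 * j, 2 * j + 1})"

definition H_pair :: "(nat \<Rightarrow> nat) \<Rightarrow> nat \<Rightarrow> (nat \<Rightarrow> nat) \<Rightarrow> nat \<Rightarrow> int poly" where
  "H_pair k u \<sigma> j =
    (if \<not> used u \<sigma> (2 * j - 1) \<and> \<not> used u \<sigma> (2 * j) then H_low2 k (2 * j - 1)
     else if \<not> used u \<sigma> (2 * j - 1) then H_low k (2 * j - 1)
     else if \<not> used u \<sigma> (2 * j) then H_low k (2 * j)
     else 1)"

definition H_sigma :: "nat \<Rightarrow> (nat \<Rightarrow> nat) \<Rightarrow> (nat \<Rightarrow> nat) \<Rightarrow> int poly" where
  "H_sigma d k \<sigma> = (let u = (d - 1) div 2 in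
     H_circ d k (up_indices u \<sigma>)
     * (\<Prod>j\<in>{j. 1 \<le> j \<and> 2 * j \<le> d}. H_pair k u \<sigma> j)
     * (if odd d \<and> \<not> used u \<sigma> d then H_low k d else 1))"

definition boolean_lattice :: "nat \<Rightarrow> (nat \<Rightarrow> nat) set" where
  "boolean_lattice u = {1..u} \<rightarrow>\<^sub>E {0, 1}"

end

theory Submission
  imports Defs
begin

text \<open>
  Both sides are computed by products of \<open>2\<times>2\<close> matrices, and the two products grow in the same way when
  two segments are put in front of a snake.

  \<^emph>\<open>The snake.\<close> Cut off the first tile \<open>T\<close> of a snake, and say that the snake continues from \<open>T\<close> to the
  tile \<open>T'\<close> in direction \<open>c\<close>. A path that leaves the SW corner of \<open>T\<close> in direction \<open>c\<close> arrives at
  the SW corner of \<open>T'\<close> and goes on there without any constraint. A path that leaves in the other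
  direction has to go around \<open>T\<close>, and it arrives at the endpoint of the edge common to \<open>T\<close> and \<open>T'\<close>, where it
  goes on like a path of the shorter snake that starts with this edge (\<open>paths_from_Cons\<close>). Replacing the
  S and E edges of a tile by its W and N edges raises the area under a path by exactly one, and a path that
  is not of minimal area contains the W and N edges of some tile (\<open>lower_cover_exists\<close>). So the rank
  is the area, normalised to be \<open>0\<close> at the bottom (\<open>path_rank_eq_area\<close>). Hence the
  polynomials \<open>F\<^sub>a\<close>, \<open>F\<^sub>b\<close> that count the paths starting to the right, respectively upwards, obey
  \<open>(F\<^sub>a, F\<^sub>b) \<mapsto> (F\<^sub>a + F\<^sub>b, q F\<^sub>b)\<close> when a letter \<open>a\<close> is put in front of the shape and
  \<open>(F\<^sub>a, F\<^sub>b) \<mapsto> (F\<^sub>a, q (F\<^sub>a + F\<^sub>b))\<close> for a letter \<open>b\<close> (\<open>sum_paths_via\<close>).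

  \<^emph>\<open>The sum over the Boolean lattice.\<close> Whether \<open>2j - 1\<close> and \<open>2j\<close> are used depends on \<open>\<sigma>\<^sub>j\<^sub>-\<^sub>1\<close> and
  \<open>\<sigma>\<^sub>j\<close> only, and the factors \<open>q\<^sup>-\<^sup>1\<close> in the product \<open>\<circ>\<close> come from neighbours \<open>\<sigma>\<^sub>j\<^sub>-\<^sub>1 = \<sigma>\<^sub>j = 1\<close>. So
  \<open>H\<^sub>\<sigma>\<close> is a product of weights of consecutive pairs (\<open>H_sigma_as_prod\<close>), and the sums \<open>V\<^sub>m(x)\<close> over
  \<open>\<sigma>\<^sub>m, \<dots>, \<sigma>\<^sub>u\<close> with \<open>\<sigma>\<^sub>m\<^sub>-\<^sub>1 = x\<close> prescribed satisfy
  \<open>V\<^sub>m(1) = [k\<^sub>2\<^sub>m] V\<^sub>m\<^sub>+\<^sub>1(0) + q\<^sup>K V\<^sub>m\<^sub>+\<^sub>1(1)\<close> and \<open>V\<^sub>m(0) = V\<^sub>m\<^sub>+\<^sub>1(0) + q [k\<^sub>2\<^sub>m\<^sub>-\<^sub>1] V\<^sub>m(1)\<close> as long as there is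
  a segment \<open>2m + 2\<close>, where \<open>K = k\<^sub>2\<^sub>m + k\<^sub>2\<^sub>m\<^sub>+\<^sub>1\<close>.

  \<^emph>\<open>Comparison.\<close> For the part of the snake whose shape starts with the run of \<open>b\<close> of segment \<open>2m\<close>,
  \<open>F\<^sub>b = q V\<^sub>m(1)\<close> and \<open>F\<^sub>a + [k\<^sub>2\<^sub>m\<^sub>-\<^sub>1] F\<^sub>b = V\<^sub>m(0)\<close> (\<open>transfer_suffix\<close>). For \<open>m = 1\<close> the left-hand side of
  the second equation is \<open>F\<^sub>a + F\<^sub>b\<close> for the whole snake, and \<open>V\<^sub>1(0)\<close> is the sum of all \<open>H\<^sub>\<sigma>\<close>.
\<close>

\<comment> \<open>These rules would merge \<open>q = [:0, 1:]\<close> into its cofactors; here it is an indeterminate.\<close>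
declare mult_pCons_left [simp del] mult_pCons_right [simp del]

section \<open>Lattice paths along a snake\<close>

fun step :: "letter \<Rightarrow> vertex \<Rightarrow> vertex" where
  "step La (x, y) = (x + 1, y)"
| "step Lb (x, y) = (x, y + 1)"

text \<open>Writing the edges of a tile as arrows in the directions \<open>La\<close> (right) and \<open>Lb\<close> (up) lets one argument
  treat both letters, with \<open>star\<close> exchanging the directions.\<close>

definition arrow :: "vertex \<Rightarrow> letter \<Rightarrow> edge" where
  "arrow v c = (v, step c v)"

fun coord :: "letter \<Rightarrow> vertex \<Rightarrow> int" where
  "coord La (x, y) = x"
| "coord Lb (x, y) = y"

lemma star_star [simp]: "star (star c) = c" and star_neq [simp]: "star c \<noteq> c" "c \<noteq> star c"
  by (cases c; simp)+

lemma fst_arrow [simp]: "fst (arrow v c) = v" and snd_arrow [simp]: "snd (arrow v c) = step c v"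
  by (simp_all add: arrow_def)

lemma coord_step [simp]: "coord e (step c v) = coord e v + (if e = c then 1 else 0)"
  by (cases v; cases c; cases e; simp)

lemma step_neq [simp]: "step c v \<noteq> v" "v \<noteq> step c v" "step La (step Lb v) \<noteq> v"
    "v \<noteq> step La (step Lb v)" "step La (step Lb v) \<noteq> step c v" "step c v \<noteq> step La (step Lb v)"
  by (cases v; cases c; simp)+

lemma step_inj [simp]: "step c v = step e v \<longleftrightarrow> c = e"
  by (cases v; cases c; cases e) auto

lemma arrow_eq_iff [simp]: "arrow v c = arrow v' c' \<longleftrightarrow> v = v' \<and> c = c'"
  by (auto simp: arrow_def)

lemma step_commute: "step c (step e v) = step e (step c v)"
  by (cases v; cases c; cases e; simp)

definition tile_edges :: "vertex \<Rightarrow> edge set" where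
  "tile_edges t = (\<Union>c. {arrow t c, arrow (step c t) (star c)})"

lemma edges_as_arrows:
  "south_edge t = arrow t La" "east_edge t = arrow (step La t) Lb"
  "west_edge t = arrow t Lb" "north_edge t = arrow (step Lb t) La"
  "ne_vertex t = step La (step Lb t)"
  by (cases t; simp add: arrow_def)+

lemma UNIV_letter: "(UNIV :: letter set) = {La, Lb}"
  using letter.exhaust by auto

lemma tile_edges_eq: "tile_edges t = {south_edge t, east_edge t, west_edge t, north_edge t}"
  by (auto simp: tile_edges_def UNIV_letter edges_as_arrows)

lemma tile_edges_letter:
  "tile_edges t = {arrow t c, arrow t (star c), arrow (step c t) (star c), arrow (step (star c) t) c}"
  by (cases c) (auto simp: tile_edges_def UNIV_letter)

text \<open>Of the four corners of a tile, the SW corner is left by two of its edges, the two side corners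
  by one each and the NE corner by none. This is what determines a path locally.\<close>

lemma tile_edges_out_of_SW:
  assumes "f \<in> tile_edges t" "fst f = t" shows "f = arrow t c \<or> f = arrow t (star c)"
  using assms unfolding tile_edges_letter[of t c] by (cases t; cases c) (auto simp: arrow_def)

lemma tile_edges_out_of_side:
  assumes "f \<in> tile_edges t" "fst f = step (star c) t" shows "f = arrow (step (star c) t) c"
  using assms by (auto simp: tile_edges_letter[of t c])

lemma tile_edges_out_of_NE: "f \<in> tile_edges t \<Longrightarrow> fst f \<noteq> step c (step (star c) t)"
  by (cases t; cases c) (auto simp: tile_edges_def UNIV_letter)

lemma tiles_from_Cons [simp]: "tiles_from t (c # s) = t # tiles_from (step c t) s"
  by (cases t; cases c; simp)

lemma tiles_from_not_Nil [simp]: "tiles_from t s \<noteq> []"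
  by (cases s; cases t) auto

lemma hd_tiles_from [simp]: "hd (tiles_from t s) = t"
  by (cases s; cases t) auto

lemma tiles_from_Nil [simp]: "tiles_from t [] = [t]"
  by (cases t) auto

lemma coord_tiles_from: "t' \<in> set (tiles_from t s) \<Longrightarrow> coord e t \<le> coord e t'"
proof (induction s arbitrary: t)
  case (Cons c s)
  then have "t' = t \<or> coord e (step c t) \<le> coord e t'" by (metis set_ConsD tiles_from_Cons)
  then show ?case by (auto split: if_splits)
qed simp

definition edges_from :: "vertex \<Rightarrow> letter list \<Rightarrow> edge set" where
  "edges_from t s = (\<Union>t'\<in>set (tiles_from t s). tile_edges t')"

definition end_vertex :: "vertex \<Rightarrow> letter list \<Rightarrow> vertex" where
  "end_vertex t s = ne_vertex (last (tiles_from t s))"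

lemma edges_from_Nil [simp]: "edges_from t [] = tile_edges t"
  by (simp add: edges_from_def)

lemma edges_from_Cons [simp]: "edges_from t (c # s) = tile_edges t \<union> edges_from (step c t) s"
  by (simp add: edges_from_def)

lemma end_vertex_Nil [simp]: "end_vertex t [] = step La (step Lb t)"
  by (simp add: end_vertex_def edges_as_arrows)

lemma end_vertex_Cons [simp]: "end_vertex t (c # s) = end_vertex (step c t) s"
  by (simp add: end_vertex_def)

text \<open>This is applied to the snake that remains behind a first tile: in the direction of the first letter its
  edges start strictly beyond the SW corner of that tile, so a coordinate tells whether an edge can
  belong to it.\<close>

lemma coord_edges_from: "e \<in> edges_from t s \<Longrightarrow> coord c t \<le> coord c (fst e)"
  by (fastforce simp: edges_from_def tile_edges_def dest: coord_tiles_from[where e = c])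

lemma coord_end_vertex: "coord c t < coord c (end_vertex t s)"
proof -
  have "coord c t \<le> coord c (last (tiles_from t s))"
    by (rule coord_tiles_from[of _ _ s]) simp
  then show ?thesis
    by (cases c) (auto simp: end_vertex_def edges_as_arrows)
qed

lemma arrow_in_edges_from [simp]: "arrow t c \<in> edges_from t s"
  by (cases s) (auto simp: tile_edges_def)

fun walk :: "vertex \<Rightarrow> edge list \<Rightarrow> vertex \<Rightarrow> bool" where
  "walk u [] v \<longleftrightarrow> u = v"
| "walk u (e # L) v \<longleftrightarrow> fst e = u \<and> walk (snd e) L v"

definition paths_from :: "vertex \<Rightarrow> letter list \<Rightarrow> edge list set" where
  "paths_from t s = {L. set L \<subseteq> edges_from t s \<and> walk t L (end_vertex t s)}"

lemma walk_iff:
  "walk u L v \<longleftrightarrow> (if L = [] then u = v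
     else fst (hd L) = u \<and> snd (last L) = v \<and> successively (\<lambda>e f. snd e = fst f) L)"
  by (induction L arbitrary: u) (auto simp: successively_Cons)

lemma lattice_paths_eq: "lattice_paths w = paths_from (0, 0) (snake_shape w)"
proof -
  have "end_vertex (0, 0) (snake_shape w) \<noteq> (0, 0)"
    using coord_end_vertex[of La "(0, 0)" "snake_shape w"] by auto
  moreover have "snake_edges w = edges_from (0, 0) (snake_shape w)"
    by (simp add: snake_edges_def edges_from_def tile_edges_eq snake_tiles_def)
  ultimately show ?thesis
    unfolding lattice_paths_def paths_from_def walk_iff
    by (auto simp: snake_tiles_def end_vertex_def split: if_splits)
qed

lemma coord_walk:
  assumes "walk u L v" and "\<And>e. e \<in> set L \<Longrightarrow> \<exists>v c. e = arrow v c" and "e \<in> set L"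
  shows "coord c u \<le> coord c (fst e)"
  using assms
proof (induction L arbitrary: u)
  case (Cons f L)
  from Cons.prems(2)[of f] obtain v' c' where f: "f = arrow v' c'" by auto
  from Cons.prems(1) f have w: "walk (step c' v') L v" "u = v'" by auto
  show ?case
  proof (cases "e = f")
    case False
    with Cons.prems(3) have "e \<in> set L" by simp
    from Cons.IH[OF w(1) Cons.prems(2) this] have "coord c (step c' v') \<le> coord c (fst e)" by simp
    with w(2) show ?thesis by (simp split: if_splits)
  qed (simp add: f w(2))
qed simp

lemma edges_from_arrow: "e \<in> edges_from t s \<Longrightarrow> \<exists>v c. e = arrow v c"
  unfolding edges_from_def tile_edges_def by blast

text \<open>Paths are monotone: once a path has made a step in the direction \<open>c\<close> from the first tile to the next one, it
  never uses an edge of the first tile again, except for the edge that both tiles share.\<close>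

lemma walk_leaves_first_tile:
  assumes "walk u L v" and "set L \<subseteq> edges_from t (c # s)" and "coord c t < coord c u"
  shows "set L \<subseteq> edges_from (step c t) s"
proof
  fix e assume e: "e \<in> set L"
  have "coord c u \<le> coord c (fst e)"
    using assms(1,2) e by (intro coord_walk[of u L v]) (blast intro: edges_from_arrow)+
  with assms(3) have "coord c t < coord c (fst e)" by simp
  with e assms(2) show "e \<in> edges_from (step c t) s"
    by (auto simp: tile_edges_letter[of t c])
qed

lemma paths_from_Nil: "paths_from t [] = (\<lambda>c. [arrow t c, arrow (step c t) (star c)]) ` UNIV"
proof
  show "paths_from t [] \<subseteq> (\<lambda>c. [arrow t c, arrow (step c t) (star c)]) ` UNIV"
  proof
    fix L assume "L \<in> paths_from t []"
    then have L: "set L \<subseteq> tile_edges t" "walk t L (step La (step Lb t))"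
      by (auto simp: paths_from_def)
    from L(2) obtain e L1 where e: "L = e # L1" by (cases L) auto
    with L tile_edges_out_of_SW[of e t] obtain c where c: "e = arrow t c" by auto
    from L(2) e c have w1: "walk (step c t) L1 (step La (step Lb t))" by simp
    then obtain f L2 where f: "L1 = f # L2" by (cases L1) auto
    with w1 L(1) e tile_edges_out_of_side[of f t "star c"]
    have fa: "f = arrow (step c t) (star c)" by simp
    have "L2 = []"
    proof (cases L2)
      case (Cons g L3)
      with w1 f fa L(1) e tile_edges_out_of_NE[of g t "star c"] show ?thesis
        by simp
    qed
    with fa
    show "L \<in> (\<lambda>c. [arrow t c, arrow (step c t) (star c)]) ` UNIV"
      using e c f by auto
  qed
qed (auto simp: paths_from_def tile_edges_def UNIV_letter step_commute)

text \<open>Leaving the SW corner in direction \<open>c\<close> leads to the SW corner of the next tile. The other direction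
  forces the second step along the opposite side of the tile, which ends at the head of the edge shared with the
  next tile; putting this shared edge in front of the remainder gives a path of the shorter snake.\<close>

lemma paths_from_Cons:
  "paths_from t (c # s) = (#) (arrow t c) ` paths_from (step c t) s \<union>
     (\<lambda>p. arrow t (star c) # arrow (step (star c) t) c # p) `
       {p. arrow (step c t) (star c) # p \<in> paths_from (step c t) s}" (is "_ = ?R")
proof
  let ?z = "end_vertex (step c t) s"
  show "paths_from t (c # s) \<subseteq> ?R"
  proof
    fix L assume "L \<in> paths_from t (c # s)"
    then have L: "set L \<subseteq> edges_from t (c # s)" "walk t L ?z"
      by (auto simp: paths_from_def)
    have z: "coord c t + 1 < coord c ?z" using coord_end_vertex[of c "step c t" s] by simp
    have tail: "coord c t < coord c (fst g)" if "g \<in> edges_from (step c t) s" for g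
      using coord_edges_from[OF that, of c] by simp
    from L(2) z obtain e L1 where e: "L = e # L1" by (cases L) auto
    with L tail[of e] have "e \<in> tile_edges t" "fst e = t" by auto
    then have "e = arrow t c \<or> e = arrow t (star c)" by (rule tile_edges_out_of_SW)
    then show "L \<in> ?R"
    proof
      assume "e = arrow t c"
      with L e have w1: "walk (step c t) L1 ?z" "set L1 \<subseteq> edges_from t (c # s)" by auto
      from walk_leaves_first_tile[OF this] w1 have "L1 \<in> paths_from (step c t) s"
        by (simp add: paths_from_def)
      with e \<open>e = _\<close> show ?thesis by blast
    next
      assume ea: "e = arrow t (star c)"
      with L e have w1: "walk (step (star c) t) L1 ?z" by auto
      moreover have "coord c (step (star c) t) \<noteq> coord c ?z" using z by simp
      ultimately obtain f L2 where f: "L1 = f # L2" by (cases L1) auto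
      with w1 L(1) e tail[of f] have "f \<in> tile_edges t" "fst f = step (star c) t" by auto
      then have fa: "f = arrow (step (star c) t) c" by (rule tile_edges_out_of_side)
      with w1 f L e have w2: "walk (step c (step (star c) t)) L2 ?z"
        "set L2 \<subseteq> edges_from t (c # s)" by auto
      from walk_leaves_first_tile[OF this] have "set L2 \<subseteq> edges_from (step c t) s"
        by simp
      with w2 have "arrow (step c t) (star c) # L2 \<in> paths_from (step c t) s"
        by (simp add: paths_from_def step_commute)
      with e ea f fa show ?thesis by blast
    qed
  qed
  show "?R \<subseteq> paths_from t (c # s)"
    by (auto simp: paths_from_def tile_edges_letter[of t c] step_commute)
qed

text \<open>Without their first edges, the paths that go around the first tile are exactly the paths of the
  shorter snake that start in the same direction, again without their first edges, with one further edge in front (\<open>paths_via_other\<close>).\<close>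

definition paths_via :: "letter \<Rightarrow> vertex \<Rightarrow> letter list \<Rightarrow> edge list set" where
  "paths_via c t s = {p. arrow t c # p \<in> paths_from t s}"

lemma paths_via_Nil: "paths_via c t [] = {[arrow (step c t) (star c)]}"
  by (auto simp: paths_via_def paths_from_Nil)

lemma paths_via_same: "paths_via c t (c # s) = paths_from (step c t) s"
  by (auto simp: paths_via_def paths_from_Cons)

lemma paths_via_other:
  "paths_via (star c) t (c # s) = (#) (arrow (step (star c) t) c) ` paths_via (star c) (step c t) s"
  by (auto simp: paths_via_def paths_from_Cons)

lemma paths_from_split: "paths_from t s = (\<Union>c. (#) (arrow t c) ` paths_via c t s)"
  by (cases s) (auto simp: paths_via_def paths_from_Cons paths_from_Nil)

lemma finite_paths_from [simp]: "finite (paths_from t s)"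
proof (induction s arbitrary: t)
  case Nil
  then show ?case by (simp add: paths_from_Nil UNIV_letter)
next
  case (Cons c s)
  have "finite {p. arrow (step c t) (star c) # p \<in> paths_from (step c t) s}"
    using finite_vimageI[OF Cons, of "(#) (arrow (step c t) (star c))"]
    by (auto simp: vimage_def)
  with Cons show ?case by (simp add: paths_from_Cons)
qed

lemma finite_paths_via [simp]: "finite (paths_via c t s)"
  using finite_vimageI[of "paths_from t s" "(#) (arrow t c)"]
  by (auto simp: vimage_def paths_via_def)

section \<open>The rank of a path\<close>

text \<open>The area between the path and the \<open>x\<close>-axis: a horizontal edge contributes its height.\<close>

definition area :: "edge list \<Rightarrow> int" where
  "area L = (\<Sum>e\<leftarrow>L. if snd (fst e) = snd (snd e) then snd (fst e) else 0)"

lemma area_simps [simp]: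
  "area [] = 0" "area (arrow v La # L) = snd v + area L" "area (arrow v Lb # L) = area L"
  "area (L @ M) = area L + area M"
  by (cases v; simp add: area_def arrow_def)+

lemma snd_step [simp]: "snd (step La v) = snd v" "snd (step Lb v) = snd v + 1"
  by (cases v; simp)+

fun bottom_area :: "vertex \<Rightarrow> letter list \<Rightarrow> int" where
  "bottom_area t [] = snd t"
| "bottom_area t (La # s) = snd t + bottom_area (step La t) s"
| "bottom_area t (Lb # s) = bottom_area (step Lb t) s - 1"

text \<open>The covering move at one of the tiles in \<open>T\<close>, for lists of edges that need not be paths; in
  this generality it survives adding a first edge.\<close>

definition flip_at :: "vertex set \<Rightarrow> edge list \<Rightarrow> edge list \<Rightarrow> bool" where
  "flip_at T L M \<longleftrightarrow> (\<exists>t\<in>T. \<exists>xs ys.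
     L = xs @ [arrow t La, arrow (step La t) Lb] @ ys \<and>
     M = xs @ [arrow t Lb, arrow (step Lb t) La] @ ys)"

lemma area_flip_at: "flip_at T L M \<Longrightarrow> area M = area L + 1"
  by (auto simp: flip_at_def)

lemma covered_by_iff:
  "covered_by w L M \<longleftrightarrow> L \<in> paths_from (0, 0) (snake_shape w) \<and> M \<in> paths_from (0, 0) (snake_shape w)
     \<and> flip_at (set (tiles_from (0, 0) (snake_shape w))) L M"
  by (simp add: covered_by_def flip_at_def lattice_paths_eq snake_tiles_def edges_as_arrows)

lemma flip_at_mono: "flip_at S L M \<Longrightarrow> S \<subseteq> T \<Longrightarrow> flip_at T L M"
  unfolding flip_at_def by blast

lemma flip_at_Cons: "flip_at T L M \<Longrightarrow> flip_at T (e # L) (e # M)"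
  unfolding flip_at_def by (metis append_Cons)

lemma flip_at_first:
  "flip_at (insert t T) (arrow t La # arrow (step La t) Lb # p) (arrow t Lb # arrow (step Lb t) La # p)"
  unfolding flip_at_def by (intro bexI[of _ t] exI[of _ "[]"] exI[of _ p]) auto

text \<open>A covering move produces a W edge first, so it does not create a leading horizontal edge.\<close>

lemma flip_at_Cons_La:
  assumes "flip_at T L (arrow t La # p)"
  obtains p' where "L = arrow t La # p'" "flip_at T p' p"
proof -
  from assms obtain u xs ys where u: "u \<in> T"
    "L = xs @ [arrow u La, arrow (step La u) Lb] @ ys"
    "arrow t La # p = xs @ [arrow u Lb, arrow (step Lb u) La] @ ys"
    unfolding flip_at_def by blast
  then obtain zs where "xs = arrow t La # zs" by (cases xs) auto
  with u that show thesis unfolding flip_at_def by auto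
qed

text \<open>A path that starts upwards has the first tile below it, hence the additional unit of area.\<close>

lemma area_ge_bottom:
  "p \<in> paths_via c t s \<Longrightarrow> bottom_area t s + of_bool (c = Lb) \<le> area (arrow t c # p)"
proof (induction s arbitrary: t c p)
  case Nil
  then show ?case by (cases c) (auto simp: paths_via_Nil)
next
  case (Cons e s)
  have all: "bottom_area u s \<le> area p'" if p': "p' \<in> paths_from u s" for u p'
  proof -
    from p' obtain c' p'' where "p'' \<in> paths_via c' u s" "p' = arrow u c' # p''"
      by (auto simp: paths_from_split)
    with Cons.IH[of p'' c' u] show ?thesis by (cases c') auto
  qed
  show ?case
  proof (cases "c = e")
    case True
    with Cons.prems all[of p "step c t"] show ?thesis
      by (cases c) (auto simp: paths_via_same)
  next
    case False
    then have c: "c = star e" by (cases c; cases e) auto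
    with Cons.prems obtain p' where p': "p = arrow (step c t) e # p'" "p' \<in> paths_via c (step e t) s"
      by (auto simp: paths_via_other)
    with Cons.IH[OF p'(2)] c show ?thesis by (cases e) auto
  qed
qed

text \<open>Follow the path from its start. Either it turns around the first tile along W and N, and this tile can be
  flipped back, or the path of the shorter snake is not minimal either and the induction hypothesis
  supplies the tile. In the second case the flip has to be carried over to the longer snake, which is only in
  question if the longer path does not contain the first edge of the shorter one; that edge is then horizontal,
  and the flip does not touch it (\<open>flip_at_Cons_La\<close>).\<close>

lemma lower_cover_exists:
  assumes "L \<in> paths_from t s" and "area L \<noteq> bottom_area t s"
  shows "\<exists>M\<in>paths_from t s. flip_at (set (tiles_from t s)) M L"
  using assms
proof (induction s arbitrary: t L)
  case Nil
  then show ?case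
    using flip_at_first[of t "{}" "[]"]
    by (auto simp: paths_from_Nil UNIV_letter)
next
  case (Cons c s)
  let ?P = "paths_from (step c t) s" and ?T = "set (tiles_from (step c t) s)"
  have T: "set (tiles_from t (c # s)) = insert t ?T" by simp
  show ?case
  proof (cases c)
    case La
    from Cons.prems(1) consider p where "p \<in> ?P" "L = arrow t La # p"
      | p where "arrow (step La t) Lb # p \<in> ?P" "L = arrow t Lb # arrow (step Lb t) La # p"
      by (auto simp: paths_from_Cons La)
    then show ?thesis
    proof cases
      case 1
      with Cons.prems(2) La have "area p \<noteq> bottom_area (step c t) s" by auto
      from Cons.IH[OF 1(1) this] obtain M where "M \<in> ?P" "flip_at ?T M p" by blast
      with 1 show ?thesis unfolding T
        by (intro bexI[of _ "arrow t La # M"])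
          (auto simp: paths_from_Cons La intro: flip_at_Cons flip_at_mono)
    next
      case 2
      then show ?thesis unfolding T
        by (intro bexI[of _ "arrow t La # arrow (step La t) Lb # p"])
          (auto simp: paths_from_Cons La intro: flip_at_first)
    qed
  next
    case Lb
    from Cons.prems(1) consider p where "p \<in> ?P" "L = arrow t Lb # p"
      | p where "arrow (step Lb t) La # p \<in> ?P" "L = arrow t La # arrow (step La t) Lb # p"
      by (auto simp: paths_from_Cons Lb)
    then show ?thesis
    proof cases
      case 1
      show ?thesis
      \<comment> \<open>The S edge of the tile above is the N edge of the first tile.\<close>
      proof (cases "\<exists>p'. p = arrow (step Lb t) La # p'")
        case True
        then obtain p' where "p = arrow (step Lb t) La # p'" by blast
        with 1 show ?thesis unfolding T
          by (intro bexI[of _ "arrow t La # arrow (step La t) Lb # p'"])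
            (auto simp: paths_from_Cons Lb intro: flip_at_first)
      next
        case False
        with 1(1) obtain p' where p': "p = arrow (step c t) Lb # p'" "p' \<in> paths_via Lb (step c t) s"
          by (auto simp: paths_from_split UNIV_letter Lb)
        with area_ge_bottom[OF p'(2)] have "area p \<noteq> bottom_area (step c t) s" by simp
        from Cons.IH[OF 1(1) this] obtain M where "M \<in> ?P" "flip_at ?T M p" by blast
        with 1 show ?thesis unfolding T
          by (intro bexI[of _ "arrow t Lb # M"])
            (auto simp: paths_from_Cons Lb intro: flip_at_Cons flip_at_mono)
      qed
    next
      case 2
      with Cons.prems(2) Lb have "area (arrow (step Lb t) La # p) \<noteq> bottom_area (step c t) s" by auto
      from Cons.IH[OF 2(1) this] obtain M where "M \<in> ?P" "flip_at ?T M (arrow (step Lb t) La # p)"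
        by blast
      then obtain p' where "arrow (step Lb t) La # p' \<in> ?P" "flip_at ?T p' p"
        by (metis flip_at_Cons_La)
      with 2 show ?thesis unfolding T
        by (intro bexI[of _ "arrow t La # arrow (step La t) Lb # p'"])
          (auto simp: paths_from_Cons Lb intro: flip_at_Cons flip_at_mono)
    qed
  qed
qed

lemma path_area_ge_bottom: "L \<in> paths_from t s \<Longrightarrow> bottom_area t s \<le> area L"
proof -
  assume "L \<in> paths_from t s"
  then obtain c p where "p \<in> paths_via c t s" "L = arrow t c # p"
    by (auto simp: paths_from_split)
  with area_ge_bottom[of p c t s] show ?thesis by (cases c) auto
qed

lemma area_chain: "(covered_by w ^^ n) M L \<Longrightarrow> area L = area M + int n"
  by (induction n arbitrary: L) (auto simp: covered_by_iff dest!: area_flip_at)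

lemma chain_from_bottom:
  assumes "L \<in> paths_from (0, 0) (snake_shape w)"
    and "area L = bottom_area (0, 0) (snake_shape w) + int n"
  shows "\<exists>M\<in>paths_from (0, 0) (snake_shape w).
    area M = bottom_area (0, 0) (snake_shape w) \<and> (covered_by w ^^ n) M L"
  using assms
proof (induction n arbitrary: L)
  case (Suc n)
  then obtain K where K: "K \<in> paths_from (0, 0) (snake_shape w)" "covered_by w K L"
    using lower_cover_exists[of L "(0, 0)" "snake_shape w"] by (auto simp: covered_by_iff)
  then have "area L = area K + 1" by (auto simp: covered_by_iff dest: area_flip_at)
  with Suc.prems Suc.IH[OF K(1)] obtain M where "M \<in> paths_from (0, 0) (snake_shape w)"
    "area M = bottom_area (0, 0) (snake_shape w)" "(covered_by w ^^ n) M K"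
    by auto
  with K(2) show ?case by (auto intro!: bexI[of _ M])
qed auto

text \<open>Every cover raises the area by one and the paths of minimal area are exactly the minimal elements, so
  all saturated chains from minimal elements to \<open>L\<close> have the same length.\<close>

lemma path_rank_eq_area:
  assumes "L \<in> paths_from (0, 0) (snake_shape w)"
  shows "path_rank w L = nat (area L - bottom_area (0, 0) (snake_shape w))"
proof -
  let ?P = "paths_from (0, 0) (snake_shape w)" and ?b = "bottom_area (0, 0) (snake_shape w)"
  have minimal: "(\<nexists>K. covered_by w K M) \<longleftrightarrow> area M = ?b" if "M \<in> ?P" for M
  proof
    assume "\<nexists>K. covered_by w K M"
    with lower_cover_exists[OF that] that show "area M = ?b"
      by (auto simp: covered_by_iff)
  next
    assume b: "area M = ?b"
    show "\<nexists>K. covered_by w K M"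
    proof
      assume "\<exists>K. covered_by w K M"
      then obtain K where "K \<in> ?P" "area M = area K + 1"
        by (auto simp: covered_by_iff dest: area_flip_at)
      with b path_area_ge_bottom[of K "(0, 0)" "snake_shape w"] show False by simp
    qed
  qed
  have "area L = ?b + int (nat (area L - ?b))"
    using path_area_ge_bottom[OF assms] by simp
  from chain_from_bottom[OF assms this]
  have ex: "\<exists>M\<in>?P. (\<nexists>K. covered_by w K M) \<and> (covered_by w ^^ nat (area L - ?b)) M L"
    using minimal by blast
  have "i = nat (area L - ?b)"
    if "\<exists>M\<in>?P. (\<nexists>K. covered_by w K M) \<and> (covered_by w ^^ i) M L" for i
  proof -
    from that obtain M where "area M = ?b" "(covered_by w ^^ i) M L"
      using minimal by blast
    then show ?thesis by (simp add: area_chain)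
  qed
  with ex show ?thesis
    unfolding path_rank_def lattice_paths_eq by (rule the_equality)
qed

lemma rank_poly_as_sum: "rank_poly w = (\<Sum>L\<in>lattice_paths w. q ^ path_rank w L)"
proof -
  have "(\<Sum>L\<in>lattice_paths w. q ^ path_rank w L) =
    (\<Sum>i\<in>path_rank w ` lattice_paths w. \<Sum>L\<in>{L \<in> lattice_paths w. path_rank w L = i}. q ^ path_rank w L)"
    by (rule sum.image_gen) (simp add: lattice_paths_eq)
  also have "\<dots> = rank_poly w"
    unfolding rank_poly_def rank_number_def by (intro sum.cong refl) simp
  finally show ?thesis by simp
qed

section \<open>Transfer matrices for the snake\<close>

text \<open>\<open>transfer c s\<close> is the rank generating polynomial of the paths that start in direction \<open>c\<close> in a snake of
  shape \<open>s\<close> (\<open>sum_paths_via\<close>).\<close>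

fun transfer :: "letter \<Rightarrow> letter list \<Rightarrow> int poly" where
  "transfer La [] = 1"
| "transfer Lb [] = q"
| "transfer La (La # s) = transfer La s + transfer Lb s"
| "transfer Lb (La # s) = q * transfer Lb s"
| "transfer La (Lb # s) = transfer La s"
| "transfer Lb (Lb # s) = q * (transfer La s + transfer Lb s)"

definition excess :: "vertex \<Rightarrow> letter list \<Rightarrow> edge list \<Rightarrow> nat" where
  "excess t s L = nat (area L - bottom_area t s)"

lemma sum_paths_from:
  "(\<Sum>p\<in>paths_from t s. f p) =
    (\<Sum>p\<in>paths_via La t s. f (arrow t La # p)) + (\<Sum>p\<in>paths_via Lb t s. f (arrow t Lb # p))"
proof -
  have "(\<Sum>p\<in>paths_from t s. f p) =
    sum f ((#) (arrow t La) ` paths_via La t s) + sum f ((#) (arrow t Lb) ` paths_via Lb t s)"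
    unfolding paths_from_split UNIV_letter
    by (simp only: UN_insert UN_empty Un_empty_right, intro sum.union_disjoint)
      (auto simp: disjoint_iff)
  then show ?thesis by (simp add: sum.reindex)
qed

text \<open>The decomposition of the paths at the first tile, with the ranks: the rank grows by one exactly if
  the first tile lies below the path, that is, if the path starts upwards.\<close>

lemma sum_paths_via:
  "(\<Sum>p\<in>paths_via c t s. q ^ excess t s (arrow t c # p)) = transfer c s"
proof (induction s arbitrary: t c)
  case Nil
  show ?case by (cases c) (simp_all add: paths_via_Nil excess_def)
next
  case (Cons e s)
  let ?t = "step e t"
  have all: "(\<Sum>p\<in>paths_from ?t s. q ^ excess ?t s p) = transfer La s + transfer Lb s"
    by (simp add: sum_paths_from Cons.IH)
  show ?case
  proof (cases "c = e")
    case True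
    have "excess t (e # s) (arrow t c # p) = excess ?t s p + (if e = La then 0 else 1)"
      if "p \<in> paths_from ?t s" for p
      using path_area_ge_bottom[OF that] True
      by (cases e) (auto simp: excess_def nat_add_distrib nat_diff_distrib)
    then have "(\<Sum>p\<in>paths_via c t (e # s). q ^ excess t (e # s) (arrow t c # p)) =
      (if e = La then 1 else q) * (\<Sum>p\<in>paths_from ?t s. q ^ excess ?t s p)"
      using True by (simp add: paths_via_same sum_distrib_left)
    with all True show ?thesis by (cases e) auto
  next
    case False
    then have c: "c = star e" by (cases c; cases e) auto
    have "excess t (e # s) (arrow t c # arrow (step c t) e # p) =
        excess ?t s (arrow ?t c # p) + (if e = La then 1 else 0)"
      if "p \<in> paths_via c ?t s" for p
      using area_ge_bottom[OF that] c
      by (cases e) (auto simp: excess_def nat_add_distrib nat_diff_distrib)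
    then have "(\<Sum>p\<in>paths_via c t (e # s). q ^ excess t (e # s) (arrow t c # p)) =
      (if e = La then q else 1) * (\<Sum>p\<in>paths_via c ?t s. q ^ excess ?t s (arrow ?t c # p))"
      by (simp add: c paths_via_other sum_distrib_left sum.reindex)
    with Cons.IH c show ?thesis by (cases e) auto
  qed
qed

lemma rank_poly_eq_transfer:
  "rank_poly w = transfer La (snake_shape w) + transfer Lb (snake_shape w)"
proof -
  have "rank_poly w = (\<Sum>L\<in>paths_from (0, 0) (snake_shape w). q ^ excess (0, 0) (snake_shape w) L)"
    unfolding rank_poly_as_sum lattice_paths_eq
    by (intro sum.cong refl) (simp add: path_rank_eq_area excess_def)
  then show ?thesis by (simp add: sum_paths_from sum_paths_via)
qed

lemma qint_0 [simp]: "qint 0 = 0"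
  by (simp add: qint_def)

lemma qint_Suc: "qint (Suc n) = qint n + q ^ n"
  by (simp add: qint_def)

lemma qint_Suc': "qint (Suc n) = 1 + q * qint n"
  unfolding qint_def sum.lessThan_Suc_shift by (simp add: sum_distrib_left)

text \<open>The powers of the two matrices, for the straight runs of the shape.\<close>

lemma transfer_replicate:
  "transfer La (replicate n La @ s) = transfer La s + qint n * transfer Lb s"
  "transfer Lb (replicate n La @ s) = q ^ n * transfer Lb s"
  "transfer La (replicate n Lb @ s) = transfer La s"
  "transfer Lb (replicate n Lb @ s) = q ^ n * transfer Lb s + q * qint n * transfer La s"
proof (induction n)
  case (Suc n)
  {
    case 4
    have "q * (q ^ n * transfer Lb s + (1 + q * qint n) * transfer La s) =
      q ^ Suc n * transfer Lb s + q * qint (Suc n) * transfer La s"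
      by (simp add: qint_Suc' algebra_simps)
    with Suc show ?case by (simp add: algebra_simps)
  }
qed (simp_all add: qint_Suc algebra_simps)

fun alternating :: "letter \<Rightarrow> nat list \<Rightarrow> letter list" where
  "alternating c [] = []"
| "alternating c (n # ns) = replicate n c @ alternating (star c) ns"

text \<open>With two letters, the run lengths and the first letter determine a word.\<close>

lemma alternating_runs: "alternating (hd xs) (map length (runs xs)) = xs"
proof (induction xs rule: runs.induct)
  case (2 x xs)
  let ?t = "takeWhile ((=) x) xs" and ?d = "dropWhile ((=) x) xs"
  have "replicate (length ?t) x = ?t"
    by (intro replicate_length_same) (auto dest: set_takeWhileD)
  moreover have "alternating (star x) (map length (runs ?d)) = ?d"
  proof (cases "?d = []")
    case False
    with hd_dropWhile[OF False] have "hd ?d = star x"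
      by (cases x; cases "hd ?d") auto
    with 2 show ?thesis by simp
  next
    case True
    show ?thesis unfolding True by simp
  qed
  ultimately show ?case by simp
qed simp

section \<open>Transfer matrices for the sum of the \<open>H\<^sub>\<sigma>\<close>\<close>

text \<open>\<open>chain_sum N e u m x\<close> is the entry at \<open>x\<close> of the matrix product \<open>N\<^sub>m \<cdots> N\<^sub>u\<close> applied to the column \<open>e\<close>,
  expanded as a sum over the index sequences. The update of \<open>\<sigma>\<close> at \<open>m - 1\<close> prescribes the row index \<open>x\<close>, also in the empty
  product \<open>m = u + 1\<close>; nothing is overwritten, because \<open>\<sigma>\<close> carries no information outside \<open>{m..u}\<close>.\<close>

definition chain_sum ::
  "(nat \<Rightarrow> nat \<Rightarrow> nat \<Rightarrow> 'a) \<Rightarrow> (nat \<Rightarrow> 'a) \<Rightarrow> nat \<Rightarrow> nat \<Rightarrow> nat \<Rightarrow> 'a::comm_ring_1" where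
  "chain_sum N e u m x =
    (\<Sum>\<sigma>\<in>{m..u} \<rightarrow>\<^sub>E {0, 1}. (\<Prod>j\<in>{m..u}. N j ((\<sigma>(m - 1 := x)) (j - 1)) (\<sigma> j)) * e ((\<sigma>(m - 1 := x)) u))"

lemma chain_sum_end: "chain_sum N e u (Suc u) x = e x"
  by (simp add: chain_sum_def)

lemma chain_sum_step:
  assumes "1 \<le> m" "m \<le> u"
  shows "chain_sum N e u m x =
    N m x 0 * chain_sum N e u (Suc m) 0 + N m x 1 * chain_sum N e u (Suc m) 1"
proof -
  let ?S = "{Suc m..u} \<rightarrow>\<^sub>E {0, 1::nat}"
  let ?f = "\<lambda>m x \<sigma>. (\<Prod>j\<in>{m..u}. N j ((\<sigma>(m - 1 := x)) (j - 1)) (\<sigma> j)) * e ((\<sigma>(m - 1 := x)) u)"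
  have ins: "{m..u} = insert m {Suc m..u}" using assms by auto
  have inj: "inj_on (\<lambda>(y, g). g(m := y)) ({0, 1} \<times> ?S)"
    by (rule inj_combinator) simp
  have f: "?f m x (g(m := y)) = N m x y * ?f (Suc m) y g" for y g
  proof -
    have "(\<Prod>j\<in>{Suc m..u}. N j (((g(m := y))(m - 1 := x)) (j - 1)) ((g(m := y)) j)) =
        (\<Prod>j\<in>{Suc m..u}. N j ((g(Suc m - 1 := y)) (j - 1)) (g j))"
      using assms by (intro prod.cong) auto
    moreover have "((g(m := y))(m - 1 := x)) u = (g(Suc m - 1 := y)) u"
      using assms by auto
    ultimately show ?thesis
      unfolding ins by (simp add: mult.assoc)
  qed
  have "chain_sum N e u m x = (\<Sum>(y, g)\<in>{0, 1} \<times> ?S. ?f m x (g(m := y)))"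
    unfolding chain_sum_def ins PiE_insert_eq
    by (subst sum.reindex[OF inj]) (simp only: o_def case_prod_unfold)
  also have "\<dots> = (\<Sum>y\<in>{0, 1}. \<Sum>g\<in>?S. N m x y * ?f (Suc m) y g)"
    by (simp only: sum.cartesian_product f)
  finally show ?thesis
    by (simp add: chain_sum_def sum_distrib_left)
qed

text \<open>The exponent of \<open>H\<^sup>2\<^sup>j\<^sup>,\<^sup>2\<^sup>j\<^sup>+\<^sup>1\<close>; its first index \<open>2j\<close> is never \<open>1\<close>.\<close>

definition up_exp :: "nat \<Rightarrow> (nat \<Rightarrow> nat) \<Rightarrow> nat \<Rightarrow> nat" where
  "up_exp d k j = k (2 * j) + k (2 * j + 1) + (if 2 * j + 1 = d then 0 else 1)"

text \<open>In the weights, \<open>x\<close> and \<open>y\<close> stand for \<open>\<sigma>\<^sub>j\<^sub>-\<^sub>1\<close> and \<open>\<sigma>\<^sub>j\<close>, which say whether \<open>2j - 1\<close> and \<open>2j\<close> are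
  used.\<close>

definition pair_weight :: "(nat \<Rightarrow> nat) \<Rightarrow> nat \<Rightarrow> nat \<Rightarrow> nat \<Rightarrow> int poly" where
  "pair_weight k j x y =
    (if x \<noteq> 1 \<and> y \<noteq> 1 then H_low2 k (2 * j - 1) else if x \<noteq> 1 then H_low k (2 * j - 1)
     else if y \<noteq> 1 then H_low k (2 * j) else 1)"

text \<open>The factor \<open>q\<^sup>-\<^sup>1\<close> for the pair \<open>2j - 2, 2j\<close> is charged to \<open>H\<^sup>2\<^sup>j\<^sup>,\<^sup>2\<^sup>j\<^sup>+\<^sup>1\<close>, so that all exponents stay
  natural numbers.\<close>

definition up_weight :: "nat \<Rightarrow> (nat \<Rightarrow> nat) \<Rightarrow> nat \<Rightarrow> nat \<Rightarrow> nat \<Rightarrow> int poly" where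
  "up_weight d k j x y =
    (if y \<noteq> 1 then 1 else if x = 1 then q ^ (up_exp d k j - 1) else q ^ up_exp d k j)"

text \<open>What is left over after position \<open>u\<close>: the single index \<open>d\<close> for odd \<open>d\<close>, and for even \<open>d\<close> the pair
  \<open>d - 1, d\<close>, whose second index is never used.\<close>

definition end_weight :: "nat \<Rightarrow> (nat \<Rightarrow> nat) \<Rightarrow> nat \<Rightarrow> int poly" where
  "end_weight d k x =
    (if odd d then if x = 1 then 1 else H_low k d else pair_weight k (d div 2) x 0)"

text \<open>Multiply by the power of \<open>q\<close> that the division takes off. This power is also a product over the positions \<open>j\<close>, with
  a factor \<open>q\<close> wherever \<open>\<sigma>\<^sub>j\<^sub>-\<^sub>1 = \<sigma>\<^sub>j = 1\<close>, and the equation can be checked factor by factor. Setting \<open>\<sigma>\<^sub>0 = 0\<close>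
  expresses that index \<open>1\<close> is never used.\<close>

lemma H_circ_as_prod:
  assumes k: "\<And>i. 1 \<le> i \<Longrightarrow> i \<le> d \<Longrightarrow> 1 \<le> k i" and u: "u = (d - 1) div 2"
  shows "H_circ d k (up_indices u \<sigma>) = (\<Prod>j\<in>{1..u}. up_weight d k j ((\<sigma>(0 := 0)) (j - 1)) (\<sigma> j))"
proof -
  let ?\<tau> = "\<sigma>(0 := 0)" and ?I = "up_indices u \<sigma>"
  have I: "?I = (*) 2 ` {j \<in> {1..u}. \<sigma> j = 1}"
    by (auto simp: up_indices_def)
  have H_up: "H_up d k (2 * j) = q ^ up_exp d k j" if "j \<in> {1..u}" for j
    using that by (auto simp: H_up_def up_exp_def)
  have pos: "1 \<le> up_exp d k j" if "j \<in> {1..u}" for j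
    using k[of "2 * j"] that u by (auto simp: up_exp_def)
  \<comment> \<open>A pair \<open>i, i + 2\<close> is recorded at its larger member \<open>i + 2 = 2j\<close>.\<close>
  have "{i \<in> ?I. i + 2 \<in> ?I} = (\<lambda>j. 2 * (j - 1)) ` {j \<in> {1..u}. ?\<tau> (j - 1) = 1 \<and> \<sigma> j = 1}"
  proof
    show "{i \<in> ?I. i + 2 \<in> ?I} \<subseteq> (\<lambda>j. 2 * (j - 1)) ` {j \<in> {1..u}. ?\<tau> (j - 1) = 1 \<and> \<sigma> j = 1}"
    proof
      fix i assume "i \<in> {i \<in> ?I. i + 2 \<in> ?I}"
      then obtain j j' where j: "i = 2 * j" "j \<in> {1..u}" "\<sigma> j = 1"
        "i + 2 = 2 * j'" "j' \<in> {1..u}" "\<sigma> j' = 1" unfolding I by auto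
      then have "j' = Suc j" by simp
      with j show "i \<in> (\<lambda>j. 2 * (j - 1)) ` {j \<in> {1..u}. ?\<tau> (j - 1) = 1 \<and> \<sigma> j = 1}"
        by (intro image_eqI[of _ _ "Suc j"]) auto
    qed
    show "(\<lambda>j. 2 * (j - 1)) ` {j \<in> {1..u}. ?\<tau> (j - 1) = 1 \<and> \<sigma> j = 1} \<subseteq> {i \<in> ?I. i + 2 \<in> ?I}"
      by (fastforce simp: I image_iff split: if_splits)
  qed
  moreover have "inj_on (\<lambda>j. 2 * (j - 1)) {j \<in> {1..u}. ?\<tau> (j - 1) = 1 \<and> \<sigma> j = 1}"
    by (auto simp: inj_on_def)
  ultimately have "q ^ card {i \<in> ?I. i + 2 \<in> ?I} =
      (\<Prod>j\<in>{j \<in> {1..u}. ?\<tau> (j - 1) = 1 \<and> \<sigma> j = 1}. q)"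
    by (simp add: card_image)
  also have "\<dots> = (\<Prod>j\<in>{1..u}. if ?\<tau> (j - 1) = 1 \<and> \<sigma> j = 1 then q else 1)"
    by (rule prod.inter_filter) simp
  finally have card: "q ^ card {i \<in> ?I. i + 2 \<in> ?I} = \<dots>" .
  have "H_circ d k ?I * q ^ card {i \<in> ?I. i + 2 \<in> ?I} = (\<Prod>i\<in>?I. H_up d k i)"
  proof (rule H_circ_exact)
    show "finite ?I" by (simp add: I)
    show "1 \<le> k i" if "i \<in> ?I" for i
      using k[of i] that u by (auto simp: up_indices_def)
  qed
  also have "\<dots> = (\<Prod>j\<in>{j \<in> {1..u}. \<sigma> j = 1}. H_up d k (2 * j))"
    unfolding I by (simp add: prod.reindex inj_on_def)
  also have "\<dots> = (\<Prod>j\<in>{1..u}. if \<sigma> j = 1 then H_up d k (2 * j) else 1)"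
    by (rule prod.inter_filter) simp
  also have "\<dots> = (\<Prod>j\<in>{1..u}. up_weight d k j (?\<tau> (j - 1)) (\<sigma> j) *
      (if ?\<tau> (j - 1) = 1 \<and> \<sigma> j = 1 then q else 1))"
  proof (intro prod.cong refl)
    fix j assume j: "j \<in> {1..u}"
    from pos[OF j] have "q ^ (up_exp d k j - 1) * q = q ^ up_exp d k j"
      by (intro power_minus_mult) simp
    then show "(if \<sigma> j = 1 then H_up d k (2 * j) else 1) = up_weight d k j (?\<tau> (j - 1)) (\<sigma> j) *
        (if ?\<tau> (j - 1) = 1 \<and> \<sigma> j = 1 then q else 1)"
      by (auto simp: up_weight_def H_up[OF j] simp del: fun_upd_apply)
  qed
  also have "\<dots> = (\<Prod>j\<in>{1..u}. up_weight d k j (?\<tau> (j - 1)) (\<sigma> j)) *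
      q ^ card {i \<in> ?I. i + 2 \<in> ?I}"
    by (simp only: prod.distrib card)
  finally show ?thesis by simp
qed

lemma H_sigma_as_prod:
  assumes k: "\<And>i. 1 \<le> i \<Longrightarrow> i \<le> d \<Longrightarrow> 1 \<le> k i" and u: "u = (d - 1) div 2" and d: "2 \<le> d"
  shows "H_sigma d k \<sigma> =
    (\<Prod>j\<in>{1..u}. pair_weight k j ((\<sigma>(0 := 0)) (j - 1)) (\<sigma> j)
       * up_weight d k j ((\<sigma>(0 := 0)) (j - 1)) (\<sigma> j)) * end_weight d k ((\<sigma>(0 := 0)) u)"
proof -
  let ?\<tau> = "\<sigma>(0 := 0)"
  have used_even: "used u \<sigma> (2 * j) \<longleftrightarrow> j \<in> {1..u} \<and> \<sigma> j = 1" for j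
    unfolding used_def by (auto, presburger+)
  have used_odd: "used u \<sigma> (2 * j - 1) \<longleftrightarrow> ?\<tau> (j - 1) = 1" if "1 \<le> j" "j \<le> Suc u" for j
  proof -
    from that(1) obtain i where i: "j = Suc i" by (cases j) auto
    have "used u \<sigma> (Suc (2 * i)) \<longleftrightarrow> i \<in> {1..u} \<and> \<sigma> i = 1"
      unfolding used_def by (auto, presburger+)
    with that i show ?thesis by auto
  qed
  have pair: "H_pair k u \<sigma> j = pair_weight k j (?\<tau> (j - 1)) (\<sigma> j)" if "j \<in> {1..u}" for j
  proof -
    from that have odd: "used u \<sigma> (2 * j - 1) \<longleftrightarrow> ?\<tau> (j - 1) = 1" by (intro used_odd) auto
    from that show ?thesis unfolding H_pair_def pair_weight_def used_even odd by simp
  qed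
  have circ: "H_circ d k (up_indices u \<sigma>) = (\<Prod>j\<in>{1..u}. up_weight d k j (?\<tau> (j - 1)) (\<sigma> j))"
    using k u by (rule H_circ_as_prod)
  have pairs: "(\<Prod>j\<in>{1..u}. H_pair k u \<sigma> j) = (\<Prod>j\<in>{1..u}. pair_weight k j (?\<tau> (j - 1)) (\<sigma> j))"
    by (intro prod.cong refl pair)
  show ?thesis
  proof (cases "odd d")
    case True
    then have d: "d = 2 * Suc u - 1" using u by (auto elim!: oddE)
    then have J: "{j. 1 \<le> j \<and> 2 * j \<le> d} = {1..u}" by auto
    have "used u \<sigma> d \<longleftrightarrow> ?\<tau> u = 1" unfolding d by (subst used_odd) auto
    then have "(if odd d \<and> \<not> used u \<sigma> d then H_low k d else 1) = end_weight d k (?\<tau> u)"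
      using True by (simp add: end_weight_def)
    then show ?thesis
      unfolding H_sigma_def Let_def u[symmetric] J circ pairs prod.distrib
      by (simp only: mult_ac)
  next
    case False
    then have d: "d = 2 * Suc u" using u d by (auto elim!: evenE)
    then have J: "{j. 1 \<le> j \<and> 2 * j \<le> d} = insert (Suc u) {1..u}" by auto
    have odd: "used u \<sigma> (2 * Suc u - 1) \<longleftrightarrow> ?\<tau> u = 1" by (subst used_odd) auto
    have "H_pair k u \<sigma> (Suc u) = end_weight d k (?\<tau> u)"
      unfolding H_pair_def pair_weight_def end_weight_def used_even odd d by simp
    moreover have "(\<Prod>j\<in>insert (Suc u) {1..u}. H_pair k u \<sigma> j) =
        H_pair k u \<sigma> (Suc u) * (\<Prod>j\<in>{1..u}. H_pair k u \<sigma> j)"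
      by (rule prod.insert) auto
    moreover have "(if odd d \<and> \<not> used u \<sigma> d then H_low k d else 1) = 1" using False by simp
    ultimately show ?thesis
      unfolding H_sigma_def Let_def u[symmetric] J circ pairs prod.distrib
      by (simp only: mult_ac mult_1_left mult_1_right)
  qed
qed

lemma sum_H_sigma:
  assumes "\<And>i. 1 \<le> i \<Longrightarrow> i \<le> d \<Longrightarrow> 1 \<le> k i" and "u = (d - 1) div 2" and "2 \<le> d"
  shows "(\<Sum>\<sigma>\<in>boolean_lattice u. H_sigma d k \<sigma>) =
    chain_sum (\<lambda>j x y. pair_weight k j x y * up_weight d k j x y) (end_weight d k) u 1 0"
  by (simp add: chain_sum_def boolean_lattice_def H_sigma_as_prod[OF assms])

section \<open>Comparison of the two recursions\<close>

text \<open>\<open>R\<close> lists the run lengths of the shape, and its suffix \<open>s\<close> starts with segment \<open>2m\<close>. The second equation adds the run of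
  segment \<open>2m - 1\<close> in the form that it takes for \<open>m = 1\<close>, where the run has \<open>k\<^sub>1 - 1\<close> letters:
  \<open>F\<^sub>a + F\<^sub>b\<close> becomes \<open>F\<^sub>a + [k\<^sub>1 - 1] F\<^sub>b + q\<^bsup>k\<^sub>1 - 1\<^esup> F\<^sub>b\<close>. For \<open>m > 1\<close> the run has \<open>k\<^sub>2\<^sub>m\<^sub>-\<^sub>1\<close> letters and
  the same expression is the component \<open>F\<^sub>a\<close> after it, which is what the step from \<open>m + 1\<close> to \<open>m\<close> uses.\<close>

lemma transfer_suffix:
  assumes R: "length R = d"
    and k: "\<And>i. 1 \<le> i \<Longrightarrow> i \<le> d \<Longrightarrow> k i = R ! (i - 1) + of_bool (i = 1 \<or> i = d)"
    and u: "u = (d - 1) div 2" and m: "1 \<le> m" "2 * m \<le> d"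
  defines "V \<equiv> chain_sum (\<lambda>j x y. pair_weight k j x y * up_weight d k j x y) (end_weight d k) u"
    and "s \<equiv> alternating Lb (drop (2 * m - 1) R)"
  shows "transfer Lb s = q * V m 1 \<and> transfer La s + qint (k (2 * m - 1)) * transfer Lb s = V m 0"
  using m unfolding s_def
proof (induction "d - 2 * m" arbitrary: m rule: less_induct)
  case less
  have weights: "pair_weight k m 0 0 = 1 + q * qint (k (2 * m - 1)) * qint (k (2 * m))"
    "pair_weight k m 0 1 = qint (k (2 * m - 1))" "pair_weight k m 1 0 = qint (k (2 * m))"
    "pair_weight k m 1 1 = 1"
    using less.prems by (simp_all add: pair_weight_def H_low_def H_low2_def)
  \<comment> \<open>The matrices end differently for even and odd \<open>d\<close>: the last segment has one letter less than its
    parameter, and for odd \<open>d\<close> the last upper symbol has the smaller exponent.\<close>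
  consider "2 * m = d" | "2 * m + 1 = d" | "2 * m + 2 \<le> d" using less.prems by linarith
  then show ?case
  proof cases
    case 1
    then have "m = Suc u" using u less.prems by auto
    then have V: "V m x = pair_weight k m x 0" for x
      using 1 by (auto simp: V_def chain_sum_end end_weight_def)
    have "drop (2 * m - 1) R = [R ! (2 * m - 1)]"
      using 1 R less.prems Cons_nth_drop_Suc[of "2 * m - 1" R] by simp
    moreover have "k (2 * m) = Suc (R ! (2 * m - 1))" using k[of "2 * m"] 1 less.prems by simp
    ultimately show ?thesis
      using transfer_replicate(3,4)[of "R ! (2 * m - 1)" "[]"]
      unfolding V weights by (simp add: qint_Suc algebra_simps)
  next
    case 2
    then have mu: "m = u" using u by auto
    have V: "V m x = pair_weight k m x 0 * H_low k d
        + pair_weight k m x 1 * up_weight d k m x 1" for x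
      unfolding V_def using less.prems 2
      by (subst chain_sum_step) (auto simp: mu chain_sum_end end_weight_def up_weight_def)
    have "drop (2 * m - 1) R = [R ! (2 * m - 1), R ! (2 * m)]"
      using 2 R less.prems Cons_nth_drop_Suc[of "2 * m - 1" R] Cons_nth_drop_Suc[of "2 * m" R]
      by simp
    moreover have "k d = Suc (R ! (2 * m))" "k (2 * m) = R ! (2 * m - 1)"
      using k[of "2 * m"] k[of d] 2 less.prems by auto
    moreover have "up_exp d k m = Suc (k (2 * m) + R ! (2 * m))"
      using 2 calculation by (simp add: up_exp_def)
    ultimately show ?thesis
      using transfer_replicate(1,2)[of "R ! (2 * m)" "[]"]
      unfolding V weights
      by (simp add: up_weight_def H_low_def transfer_replicate(3,4) qint_Suc' power_add algebra_simps)
  next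
    case 3
    let ?s = "alternating Lb (drop (2 * Suc m - 1) R)"
    have "m \<le> u" using 3 u by auto
    then have V: "V m x = pair_weight k m x 0 * up_weight d k m x 0 * V (Suc m) 0
        + pair_weight k m x 1 * up_weight d k m x 1 * V (Suc m) 1" for x
      unfolding V_def using less.prems by (subst chain_sum_step) auto
    have both: "transfer Lb ?s = q * V (Suc m) 1 \<and>
        transfer La ?s + qint (k (2 * Suc m - 1)) * transfer Lb ?s = V (Suc m) 0"
      using 3 less.prems by (intro less.hyps) auto
    have IH: "transfer Lb ?s = q * V (Suc m) 1"
      "V (Suc m) 0 = transfer La ?s + qint (k (2 * m + 1)) * transfer Lb ?s"
      using conjunct1[OF both] conjunct2[OF both] by simp_all
    have "drop (2 * m - 1) R = k (2 * m) # k (2 * m + 1) # drop (2 * Suc m - 1) R"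
      using 3 R less.prems Cons_nth_drop_Suc[of "2 * m - 1" R] Cons_nth_drop_Suc[of "2 * m" R]
        k[of "2 * m"] k[of "2 * m + 1"]
      by simp
    then have Lb: "transfer Lb (alternating Lb (drop (2 * m - 1) R)) =
        q ^ k (2 * m) * (q ^ k (2 * m + 1) * transfer Lb ?s) + q * qint (k (2 * m)) * V (Suc m) 0"
      and La: "transfer La (alternating Lb (drop (2 * m - 1) R)) = V (Suc m) 0"
      by (simp_all only: alternating.simps star.simps transfer_replicate IH(2))
    have "up_exp d k m = Suc (k (2 * m) + k (2 * m + 1))"
      using 3 by (simp add: up_exp_def)
    then show ?thesis
      unfolding La Lb IH(1) V weights by (simp add: up_weight_def power_add algebra_simps)
  qed
qed

theorem theorem8p3:
  fixes w :: "letter list" and d u :: nat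
  assumes "starts_right w"
    and "d = num_segments w" and "d \<ge> 2"
    and "u = (d - 1) div 2"
  shows "rank_poly w = (\<Sum>\<sigma>\<in>boolean_lattice u. H_sigma d (seg_len w) \<sigma>)"
proof -
  let ?R = "map length (runs (snake_shape w))" and ?k = "seg_len w"
  have R: "length ?R = d" using assms(2) by (simp add: num_segments_def segment_tiles_def)
  have R_pos: "1 \<le> ?R ! i" if "i < d" for i
  proof -
    have "[] \<notin> set (runs xs)" for xs :: "letter list" by (induction xs rule: runs.induct) auto
    moreover from that R have "runs (snake_shape w) ! i \<in> set (runs (snake_shape w))" by simp
    ultimately have "runs (snake_shape w) ! i \<noteq> []" by metis
    with that R show ?thesis by (simp add: Suc_le_eq)
  qed
  have k: "?k i = ?R ! (i - 1) + of_bool (i = 1 \<or> i = d)" if "1 \<le> i" "i \<le> d" for i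
    using that R by (auto simp: seg_len_def segment_tiles_def assms(2)[symmetric])
  have k_pos: "1 \<le> ?k i" if "1 \<le> i" "i \<le> d" for i
    using R_pos[of "i - 1"] k[OF that] that by auto
  define s where "s = alternating Lb (drop 1 ?R)"
  have "snake_shape w = alternating La ?R"
    using alternating_runs[of "snake_shape w"] assms(1) by (simp add: starts_right_def)
  moreover have "?R = ?R ! 0 # drop 1 ?R"
    using R assms(3) Cons_nth_drop_Suc[of 0 ?R] by simp
  ultimately have "snake_shape w = replicate (?R ! 0) La @ s"
    unfolding s_def by (metis alternating.simps(2) star.simps(1))
  then have "rank_poly w = transfer La (replicate (?R ! 0) La @ s) + transfer Lb (replicate (?R ! 0) La @ s)"
    by (simp only: rank_poly_eq_transfer)
  also have "\<dots> = transfer La s + qint (?k 1) * transfer Lb s"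
    using k[of 1] assms(3) by (simp add: transfer_replicate qint_Suc algebra_simps)
  also have "\<dots> = (\<Sum>\<sigma>\<in>boolean_lattice u. H_sigma d ?k \<sigma>)"
    using transfer_suffix[OF R k assms(4), of 1, THEN conjunct2] assms(3)
      sum_H_sigma[of d ?k u, OF k_pos assms(4,3)]
    by (simp add: s_def)
  finally show ?thesis .
qed

end
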